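(* Suppose $F:\mathbb{R}^d\to\mathbb{R}^d$ is $\mu$-strongly monotone and $\alpha$-symmetric $(L_0,L_1)$-Lipschitz with $\alpha\in(0,1)$, and $F(x_* )=0$. Then the extragradient method with $$\gamma_k=\omega_k=\frac{\nu}{2K_0+\left(2K_1+2^{1-\alpha}K_2^{1-\alpha}\right)\|F(x_k)\|^\alpha}$$ satisfies, for all $k\ge0$, $\|x_{k+1}-x_*\|^2\le(1-\varrho)^{k+1}\|x_0-x_*\|^2$, where $$\varrho=\frac{\nu\mu}{2K_0+\left(2K_1+2^{1-\alpha}K_2^{1-\alpha}\right)\left(K_0+K_2\|x_0-x_*\|^{\frac{\alpha}{1-\alpha}}\right)^\alpha\|x_0-x_*\|^\alpha}$$ and $\nu\in(0,1)$ is a constant such that $1-\nu-\nu^2=0$.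
   Context: Extragradient method (EG): $\hat x_k=x_k-\gamma_kF(x_k)$, $x_{k+1}=x_k-\omega_kF(\hat x_k)$, started from $x_0\in\mathbb{R}^d$. $F$ is $\alpha$-symmetric $(L_0,L_1)$-Lipschitz ($L_0,L_1\ge0$) if for all $x,y$: $\|F(x)-F(y)\|\le\left(L_0+L_1\max_{\theta\in[0,1]}\|F(\theta x+(1-\theta)y)\|^\alpha\right)\|x-y\|$. Constants: $K_0=L_0\left(2^{\frac{\alpha^2}{1-\alpha}}+1\right)$, $K_1=L_1\cdot2^{\frac{\alpha^2}{1-\alpha}}$, $K_2=L_1^{\frac1{1-\alpha}}\cdot2^{\frac{\alpha^2}{1-\alpha}}\cdot3^\alpha(1-\alpha)^{\frac\alpha{1-\alpha}}$. $\mu$-strongly monotone ($\mu>0$): $\langle F(x)-F(y),x-y\rangle\ge\mu\|x-y\|^2$ for all $x,y$. *)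

theory Defs
  imports "HOL-Analysis.Analysis"
begin

definition strongly_monotone :: "real \<Rightarrow> (real ^ 'n \<Rightarrow> real ^ 'n) \<Rightarrow> bool" where
  "strongly_monotone \<mu> F \<longleftrightarrow>
     \<mu> > 0 \<and> (\<forall>x y. (F x - F y) \<bullet> (x - y) \<ge> \<mu> * (norm (x - y))\<^sup>2)"

text \<open>
  The maximum over \<open>\<theta>\<close> is rendered through a maximiser \<open>t\<close>, so that its existence is part of
  the condition. Using the real-valued supremum instead would give an unspecified value for an
  \<open>F\<close> that is unbounded on a segment.
\<close>

definition alpha_symmetric_Lipschitz ::
    "real \<Rightarrow> real \<Rightarrow> real \<Rightarrow> (real ^ 'n \<Rightarrow> real ^ 'n) \<Rightarrow> bool" where
  "alpha_symmetric_Lipschitz \<alpha> L\<^sub>0 L\<^sub>1 F \<longleftrightarrow>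
     L\<^sub>0 \<ge> 0 \<and> L\<^sub>1 \<ge> 0 \<and>
     (\<forall>x y. \<exists>t.
        is_arg_max (\<lambda>\<theta>. norm (F (\<theta> *\<^sub>R x + (1 - \<theta>) *\<^sub>R y)) powr \<alpha>) (\<lambda>\<theta>. \<theta> \<in> {0..1}) t \<and>
        norm (F x - F y)
          \<le> (L\<^sub>0 + L\<^sub>1 * norm (F (t *\<^sub>R x + (1 - t) *\<^sub>R y)) powr \<alpha>) * norm (x - y))"

definition K\<^sub>0 :: "real \<Rightarrow> real \<Rightarrow> real" where
  "K\<^sub>0 \<alpha> L\<^sub>0 = L\<^sub>0 * (2 powr (\<alpha>\<^sup>2 / (1 - \<alpha>)) + 1)"

definition K\<^sub>1 :: "real \<Rightarrow> real \<Rightarrow> real" where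
  "K\<^sub>1 \<alpha> L\<^sub>1 = L\<^sub>1 * 2 powr (\<alpha>\<^sup>2 / (1 - \<alpha>))"

definition K\<^sub>2 :: "real \<Rightarrow> real \<Rightarrow> real" where
  "K\<^sub>2 \<alpha> L\<^sub>1 =
     L\<^sub>1 powr (1 / (1 - \<alpha>)) * 2 powr (\<alpha>\<^sup>2 / (1 - \<alpha>)) * 3 powr \<alpha> * (1 - \<alpha>) powr (\<alpha> / (1 - \<alpha>))"

definition extragradient ::
    "(real ^ 'n \<Rightarrow> real ^ 'n) \<Rightarrow> (nat \<Rightarrow> real) \<Rightarrow> (nat \<Rightarrow> real) \<Rightarrow>
     (nat \<Rightarrow> real ^ 'n) \<Rightarrow> (nat \<Rightarrow> real ^ 'n) \<Rightarrow> bool" where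
  "extragradient F \<gamma> \<omega> x xhat \<longleftrightarrow>
     (\<forall>k. xhat k = x k - \<gamma> k *\<^sub>R F (x k) \<and>
          x (Suc k) = x k - \<omega> k *\<^sub>R F (xhat k))"

end

theory Submission imports Defs begin

text \<open>
  The \<open>\<alpha>\<close>-symmetric condition controls \<open>F x - F y\<close> through the size of \<open>F\<close> on the whole segment
  from \<open>y\<close> to \<open>x\<close>. The first idea is to trade this for the size of \<open>F\<close> at the endpoint \<open>y\<close> alone.
  Along the segment, \<open>h = \<parallel>F\<parallel>\<close> satisfies the differential inequality
  \<open>h' \<le> (L\<^sub>0 + L\<^sub>1 h\<^sup>\<alpha>) d\<close> with \<open>d = \<parallel>x - y\<parallel>\<close>. Since \<open>\<alpha> < 1\<close>, the shifted function
  \<open>u = h + (L\<^sub>0/L\<^sub>1) powr (1/\<alpha>)\<close> satisfies \<open>u' \<le> M u\<^sup>\<alpha>\<close> with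
  \<open>M = L\<^sub>1 2 powr (1 - \<alpha>) d\<close>, so \<open>u powr (1 - \<alpha>)\<close> grows at most
  linearly (\<open>power_growth_comparison\<close>). Undoing the powers gives
  \<open>\<parallel>F x - F y\<parallel> \<le> (K\<^sub>0 + K\<^sub>1 \<parallel>F y\<parallel>\<^sup>\<alpha> + K\<^sub>2 d powr (\<alpha>/(1 - \<alpha>))) d\<close>
  (\<open>alpha_symmetric_Lipschitz_base_point_bound\<close>), and this bound is all that is needed of the
  \<open>\<alpha>\<close>-symmetric condition. It enters in three ways.

  Between \<open>x k\<close> and \<open>xhat k\<close>, which are \<open>\<gamma> k * \<parallel>F (x k)\<parallel>\<close> apart, the step size is chosen so that
  \<open>\<gamma> k \<parallel>F (x k) - F (xhat k)\<parallel> \<le> \<nu> \<parallel>x k - xhat k\<parallel>\<close> (\<open>stepsize_bound\<close>). As two points merge,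
  comparison with strong monotonicity gives \<open>\<mu> \<le> K\<^sub>0 + K\<^sub>1 \<parallel>F x\<parallel>\<^sup>\<alpha>\<close>
  (\<open>strong_monotonicity_modulus_le\<close>), so the denominator of \<open>\<gamma> k\<close> is at least \<open>2 \<mu>\<close>; it is in
  particular positive, and \<open>2 \<gamma> k \<mu> \<le> \<nu>\<close>. Finally, with the solution as base point, it bounds
  \<open>\<parallel>F (x k)\<parallel>\<close> by the distance to the solution and hence \<open>\<gamma> k\<close> from below.

  The usual extragradient estimate then contracts the squared distance by \<open>1 - \<gamma> k \<mu>\<close> as soon as
  \<open>2 \<gamma> k \<mu> \<le> 1 - \<nu>\<^sup>2\<close> (\<open>extragradient_step_contracts\<close>). The equation for \<open>\<nu>\<close> says exactly that
  \<open>1 - \<nu>\<^sup>2 = \<nu>\<close>, which makes this condition the bound just obtained. Distances to the solution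
  therefore decrease, so every \<open>\<gamma> k \<mu>\<close> is at least \<open>\<rho>\<close>, whose denominator is the step-size
  denominator with \<open>\<parallel>F (x k)\<parallel>\<close> replaced by its bound in terms of the initial distance.
\<close>

section \<open>Sums and powers\<close>

text \<open>
  Each summand has a share \<open>c / (a + b)\<close> in \<open>[0, 1]\<close>, which is at most its own power with exponent
  \<open>\<alpha> \<le> 1\<close>; the two shares add up to one.
\<close>

lemma powr_add_le_powr_add:
  fixes a b \<alpha> :: real
  assumes "0 \<le> a" "0 \<le> b" "0 < \<alpha>" "\<alpha> \<le> 1"
  shows "(a + b) powr \<alpha> \<le> a powr \<alpha> + b powr \<alpha>"
proof (cases "a + b = 0")
  case False
  then have pos: "0 < a + b" using assms by simp
  have part: "c / (a + b) * (a + b) powr \<alpha> \<le> c powr \<alpha>" if "0 \<le> c" "c \<le> a + b" for c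
  proof -
    have "(c / (a + b)) powr 1 \<le> (c / (a + b)) powr \<alpha>"
      by (rule powr_mono') (use that pos assms in auto)
    then have "c / (a + b) \<le> (c / (a + b)) powr \<alpha>"
      using that pos by simp
    then have "c / (a + b) * (a + b) powr \<alpha> \<le> (c / (a + b)) powr \<alpha> * (a + b) powr \<alpha>"
      by (rule mult_right_mono) simp
    also have "\<dots> = (c / (a + b) * (a + b)) powr \<alpha>"
      by (simp only: powr_mult)
    also have "\<dots> = c powr \<alpha>" using pos by simp
    finally show ?thesis .
  qed
  have "(a + b) powr \<alpha> = a / (a + b) * (a + b) powr \<alpha> + b / (a + b) * (a + b) powr \<alpha>"
    using pos by (simp only: distrib_right[symmetric] add_divide_distrib[symmetric]) simp
  also have "\<dots> \<le> a powr \<alpha> + b powr \<alpha>"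
    using assms by (intro add_mono part) auto
  finally show ?thesis .
qed (use assms in auto)

text \<open>Convexity of \<open>t \<mapsto> t powr q\<close> at the midpoint of \<open>a\<close> and \<open>b\<close>.\<close>

lemma powr_add_le_two_powr:
  fixes a b q :: real
  assumes "0 \<le> a" "0 \<le> b" "1 \<le> q"
  shows "(a + b) powr q \<le> 2 powr (q - 1) * (a powr q + b powr q)"
proof -
  have two: "1 \<le> (2::real) powr (q - 1)" using assms by (intro ge_one_powr_ge_zero) auto
  consider "a = 0" | "b = 0" | "0 < a" "0 < b" using assms by fastforce
  then show ?thesis
  proof cases
    case 1
    then show ?thesis using mult_right_mono[OF two, of "b powr q"] assms by simp
  next
    case 2
    then show ?thesis using mult_right_mono[OF two, of "a powr q"] assms by simp
  next
    case 3
    have "((1 - 1/2) *\<^sub>R a + (1/2) *\<^sub>R b) powr q \<le> (1 - 1/2) * a powr q + (1/2) * b powr q"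
      by (rule convex_onD[OF powr_convex[OF assms(3)]]) (use 3 in auto)
    then have half: "((1/2) * (a + b)) powr q \<le> (1/2) * (a powr q + b powr q)"
      by (simp add: add_divide_distrib)
    have "(a + b) powr q = (2 * ((1/2) * (a + b))) powr q" by (simp del: distrib_left_numeral)
    also have "\<dots> = 2 powr q * ((1/2) * (a + b)) powr q" by (simp only: powr_mult)
    also have "\<dots> \<le> 2 powr q * ((1/2) * (a powr q + b powr q))"
      by (rule mult_left_mono[OF half]) simp
    also have "\<dots> = 2 powr (q - 1) * (a powr q + b powr q)" by (simp add: powr_diff)
    finally show ?thesis .
  qed
qed

text \<open>The preceding inequality with exponent \<open>1/\<alpha>\<close>, applied to \<open>a powr \<alpha>\<close> and \<open>b powr \<alpha>\<close>.\<close>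

lemma powr_add_powr_le:
  fixes a b \<alpha> :: real
  assumes "0 \<le> a" "0 \<le> b" "0 < \<alpha>" "\<alpha> \<le> 1"
  shows "a powr \<alpha> + b powr \<alpha> \<le> 2 powr (1 - \<alpha>) * (a + b) powr \<alpha>"
proof -
  let ?s = "a powr \<alpha> + b powr \<alpha>"
  have "?s powr (1/\<alpha>) \<le> 2 powr (1/\<alpha> - 1) * ((a powr \<alpha>) powr (1/\<alpha>) + (b powr \<alpha>) powr (1/\<alpha>))"
    using assms by (intro powr_add_le_two_powr) auto
  also have "\<dots> = 2 powr (1/\<alpha> - 1) * (a + b)" using assms by (simp add: powr_powr)
  finally have "(?s powr (1/\<alpha>)) powr \<alpha> \<le> (2 powr (1/\<alpha> - 1) * (a + b)) powr \<alpha>"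
    using assms by (intro powr_mono2) auto
  moreover have "(?s powr (1/\<alpha>)) powr \<alpha> = ?s" using assms by (simp add: powr_powr)
  moreover have "(1/\<alpha> - 1) * \<alpha> = 1 - \<alpha>" using assms by (simp add: field_simps)
  ultimately show ?thesis by (simp add: powr_mult powr_powr)
qed

section \<open>Comparison for sublinear power growth\<close>

text \<open>
  The increment condition is an integrated form of \<open>u' \<le> M u\<^sup>\<alpha>\<close> that assumes no differentiability:
  \<open>r\<close> is any point where \<open>u\<close> is large enough to account for the increment. The equation
  \<open>h' = K / (1 - \<alpha>) h\<^sup>\<alpha>\<close> has the solutions \<open>h t = (A + K t) powr (1 / (1 - \<alpha>))\<close>, for which
  \<open>h powr (1 - \<alpha>)\<close> is affine. If \<open>h\<close> starts strictly above \<open>u\<close> and \<open>K > (1 - \<alpha>) M\<close>, then \<open>u\<close> cannot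
  catch up: at a first contact time \<open>\<tau>\<close>, the function \<open>h\<close> is steeper than \<open>M (h \<tau>)\<^sup>\<alpha>\<close>, while just
  before \<open>\<tau>\<close> the increments of \<open>u\<close> have at most that slope because \<open>u \<le> h \<le> h \<tau>\<close> there. Letting \<open>A\<close>
  and \<open>K\<close> tend to their limits gives the claim. The strict start also avoids the
  non-uniqueness of solutions through zero.
\<close>

lemma power_growth_comparison:
  fixes u :: "real \<Rightarrow> real" and T M \<alpha> :: real
  assumes T: "0 \<le> T" and M: "0 \<le> M" and \<alpha>: "0 < \<alpha>" "\<alpha> < 1"
    and cont: "continuous_on {0..T} u"
    and nonneg: "\<And>t. 0 \<le> u t"
    and incr: "\<And>s t. 0 \<le> s \<Longrightarrow> s \<le> t \<Longrightarrow> t \<le> T \<Longrightarrow>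
                 \<exists>r\<in>{s..t}. u t - u s \<le> M * u r powr \<alpha> * (t - s)"
  shows "u T powr (1 - \<alpha>) \<le> u 0 powr (1 - \<alpha>) + (1 - \<alpha>) * M * T"
proof -
  have strict: "u T powr (1 - \<alpha>) \<le> A + K * T"
    if A: "u 0 powr (1 - \<alpha>) < A" and K: "(1 - \<alpha>) * M < K" for A K
  proof (rule ccontr)
    define q where "q = 1 / (1 - \<alpha>)"
    define h where "h t = (A + K * t) powr q" for t
    have q: "1 < q" "(1 - \<alpha>) * q = 1" "q - 1 = q * \<alpha>"
      using \<alpha> by (auto simp: q_def field_simps)
    have Apos: "0 < A" using A powr_ge_zero[of "u 0" "1 - \<alpha>"] by linarith
    have Kpos: "0 < K" using K M \<alpha> mult_nonneg_nonneg[of "1 - \<alpha>" M] by linarith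
    have base: "0 < A + K * t" if "0 \<le> t" for t
      using that Apos Kpos by (simp add: add_pos_nonneg)
    have h_mono: "h s \<le> h t" if "0 \<le> s" "s \<le> t" for s t
      unfolding h_def using that base[of s] Kpos q(1) by (intro powr_mono2) auto
    have h_pos: "0 < h t" if "0 \<le> t" for t
      unfolding h_def using base[OF that] by simp
    have h_root: "h t powr (1 - \<alpha>) = A + K * t" if "0 \<le> t" for t
      unfolding h_def using base[OF that] q(2) by (simp add: powr_powr mult.commute[of q])
    have h_deriv: "(h has_real_derivative q * K * h t powr \<alpha>) (at t)" if "0 \<le> t" for t
    proof -
      have "((\<lambda>t. (A + K * t) powr q) has_real_derivative q * K * (A + K * t) powr (q - 1)) (at t)"
        using base[OF that] by (auto intro!: derivative_eq_intros)
      then show ?thesis unfolding h_def by (simp add: powr_powr q(3))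
    qed
    have u0: "u 0 < h 0"
    proof (rule ccontr)
      assume "\<not> u 0 < h 0"
      then have "h 0 powr (1 - \<alpha>) \<le> u 0 powr (1 - \<alpha>)"
        using h_pos[of 0] \<alpha> by (intro powr_mono2) auto
      then show False using A h_root[of 0] by simp
    qed
    assume "\<not> u T powr (1 - \<alpha>) \<le> A + K * T"
    then have "h T powr (1 - \<alpha>) < u T powr (1 - \<alpha>)" using h_root[OF T] by simp
    then have uT: "h T < u T"
      using powr_mono2[of "1 - \<alpha>" "u T" "h T"] \<alpha> nonneg[of T] by linarith
    have cont_h: "continuous_on {0..T} h"
      using h_deriv by (intro DERIV_continuous_on) (auto intro: has_field_derivative_at_within)
    have cont_d: "continuous_on {0..T} (\<lambda>t. u t - h t)"
      by (intro continuous_intros cont cont_h)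
    \<comment> \<open>The set of contact times; it is compact, so there is a first one.\<close>
    define Z where "Z = {t \<in> {0..T}. u t - h t = 0}"
    have zero: "\<exists>z\<in>Z. z \<le> t" if "0 \<le> t" "t \<le> T" "h t \<le> u t" for t
    proof -
      have "\<exists>z. 0 \<le> z \<and> z \<le> t \<and> u z - h z = 0"
        by (rule IVT') (use that u0 continuous_on_subset[OF cont_d] in auto)
      then show ?thesis using that by (auto simp: Z_def)
    qed
    have "closed Z"
      unfolding Z_def by (rule continuous_closed_preimage_constant[OF cont_d]) simp
    moreover have "bounded Z"
      by (rule bounded_subset[of "{0..T}"]) (auto simp: Z_def)
    ultimately have "compact Z"
      by (simp add: compact_eq_bounded_closed)
    moreover have "Z \<noteq> {}" using zero[of T] T uT by auto
    ultimately obtain \<tau> where \<tau>: "\<tau> \<in> Z" "\<And>z. z \<in> Z \<Longrightarrow> \<tau> \<le> z"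
      using compact_attains_inf[of Z] by auto
    have contact: "u \<tau> = h \<tau>" "0 \<le> \<tau>" "\<tau> \<le> T" using \<tau>(1) by (auto simp: Z_def)
    have "\<tau> \<noteq> 0" using contact u0 by auto
    then have \<tau>pos: "0 < \<tau>" using contact by simp
    have below: "u s < h s" if s: "0 \<le> s" "s < \<tau>" for s
    proof (rule ccontr)
      assume "\<not> u s < h s"
      then obtain z where "z \<in> Z" "z \<le> s" using zero[of s] s contact by auto
      then show False using \<tau>(2)[of z] s by simp
    qed
    let ?c = "M * h \<tau> powr \<alpha>"
    \<comment> \<open>Strict steepness of \<open>h\<close> at contact is where \<open>K > (1 - \<alpha>) M\<close> is used.\<close>
    have "M < q * K" using K \<alpha> by (simp add: q_def field_simps)
    then have "0 < q * K * h \<tau> powr \<alpha> - ?c"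
      using h_pos[of \<tau>] contact by (simp add: mult_strict_right_mono)
    moreover have "((\<lambda>s. h s - ?c * s) has_real_derivative q * K * h \<tau> powr \<alpha> - ?c) (at \<tau>)"
      using h_deriv[OF contact(2)] by (auto intro!: derivative_eq_intros)
    ultimately obtain d where d: "0 < d"
      "\<And>e. 0 < e \<Longrightarrow> e < d \<Longrightarrow> h (\<tau> - e) - ?c * (\<tau> - e) < h \<tau> - ?c * \<tau>"
      using DERIV_pos_inc_left by blast
    define e where "e = min (d / 2) \<tau>"
    have e: "0 < e" "e < d" "e \<le> \<tau>" using d(1) \<tau>pos by (auto simp: e_def)
    define s where "s = \<tau> - e"
    have s: "0 \<le> s" "s < \<tau>" using e by (auto simp: s_def)
    have steep: "h s < h \<tau> - ?c * (\<tau> - s)" using d(2)[OF e(1,2)] by (simp add: s_def algebra_simps)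
    obtain r where r: "r \<in> {s..\<tau>}" "u \<tau> - u s \<le> M * u r powr \<alpha> * (\<tau> - s)"
      using incr[of s \<tau>] s contact by auto
    have "u r \<le> h r" using below[of r] r(1) s(1) contact(1) by (cases "r = \<tau>") auto
    also have "\<dots> \<le> h \<tau>" using r(1) s by (intro h_mono) auto
    finally have "u r powr \<alpha> \<le> h \<tau> powr \<alpha>" using \<alpha> nonneg by (intro powr_mono2) auto
    then have "M * u r powr \<alpha> * (\<tau> - s) \<le> ?c * (\<tau> - s)"
      using M s by (intro mult_right_mono mult_left_mono) auto
    then show False using r(2) contact(1) steep below[OF s] by linarith
  qed
  show ?thesis
  proof (rule field_le_epsilon)
    fix e :: real assume "0 < e"
    \<comment> \<open>Raising both \<open>A\<close> and \<open>K\<close> by \<open>\<delta>\<close> costs \<open>\<delta> (1 + T)\<close> in total.\<close>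
    define \<delta> where "\<delta> = e / (1 + T)"
    have \<delta>: "0 < \<delta>" "\<delta> * (1 + T) = e" using T \<open>0 < e\<close> by (auto simp: \<delta>_def)
    have "u T powr (1 - \<alpha>) \<le> (u 0 powr (1 - \<alpha>) + \<delta>) + ((1 - \<alpha>) * M + \<delta>) * T"
      using \<delta> by (intro strict) auto
    then show "u T powr (1 - \<alpha>) \<le> u 0 powr (1 - \<alpha>) + (1 - \<alpha>) * M * T + e"
      using \<delta>(2) by (simp add: algebra_simps)
  qed
qed


section \<open>Replacing the segment maximum by an endpoint value\<close>

text \<open>
  The condition applies to every subsegment as well, with a maximiser inside that subsegment.
  This localisation is what turns it into a differential inequality.
\<close>

lemma alpha_symmetric_Lipschitz_segment:
  fixes F :: "real ^ 'n \<Rightarrow> real ^ 'n" and \<alpha> L0 L1 :: real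
  assumes lip: "alpha_symmetric_Lipschitz \<alpha> L0 L1 F"
    and st: "s \<le> t"
  shows "\<exists>r\<in>{s..t}. norm (F (t *\<^sub>R x + (1 - t) *\<^sub>R y) - F (s *\<^sub>R x + (1 - s) *\<^sub>R y))
           \<le> (L0 + L1 * norm (F (r *\<^sub>R x + (1 - r) *\<^sub>R y)) powr \<alpha>) * ((t - s) * norm (x - y))"
proof -
  let ?p = "\<lambda>\<theta>. \<theta> *\<^sub>R x + (1 - \<theta>) *\<^sub>R y"
  obtain \<theta> where \<theta>: "\<theta> \<in> {0..1}"
    "norm (F (?p t) - F (?p s))
       \<le> (L0 + L1 * norm (F (\<theta> *\<^sub>R ?p t + (1 - \<theta>) *\<^sub>R ?p s)) powr \<alpha>) * norm (?p t - ?p s)"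
    using lip unfolding alpha_symmetric_Lipschitz_def is_arg_max_linorder by blast
  define r where "r = s + \<theta> * (t - s)"
  have "\<theta> * (t - s) \<le> 1 * (t - s)" "0 \<le> \<theta> * (t - s)"
    using \<theta>(1) st mult_right_mono[of \<theta> 1 "t - s"] by auto
  then have "r \<in> {s..t}" by (simp add: r_def)
  moreover have "\<theta> *\<^sub>R ?p t + (1 - \<theta>) *\<^sub>R ?p s = ?p r"
    by (simp add: r_def algebra_simps)
  moreover have "?p t - ?p s = (t - s) *\<^sub>R (x - y)"
    by (simp add: algebra_simps)
  then have "norm (?p t - ?p s) = (t - s) * norm (x - y)" using st by simp
  ultimately show ?thesis using \<theta>(2) by auto
qed

text \<open>
  The existence of a maximiser bounds \<open>F\<close> on the segment, so the factor in front of the distance is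
  bounded and \<open>F\<close> is Lipschitz there.
\<close>

lemma alpha_symmetric_Lipschitz_continuous_segment:
  fixes F :: "real ^ 'n \<Rightarrow> real ^ 'n" and \<alpha> L0 L1 :: real
  assumes lip: "alpha_symmetric_Lipschitz \<alpha> L0 L1 F"
  shows "continuous_on {0..1} (\<lambda>t. F (t *\<^sub>R x + (1 - t) *\<^sub>R y))"
proof -
  let ?p = "\<lambda>\<theta>. \<theta> *\<^sub>R x + (1 - \<theta>) *\<^sub>R y"
  have L: "0 \<le> L0" "0 \<le> L1" using lip by (auto simp: alpha_symmetric_Lipschitz_def)
  obtain m where m: "\<And>r. r \<in> {0..1} \<Longrightarrow> norm (F (?p r)) powr \<alpha> \<le> norm (F (?p m)) powr \<alpha>"
    using lip unfolding alpha_symmetric_Lipschitz_def is_arg_max_linorder by blast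
  let ?C = "(L0 + L1 * norm (F (?p m)) powr \<alpha>) * norm (x - y)"
  have ordered: "dist (F (?p s)) (F (?p t)) \<le> ?C * dist s t"
    if "s \<in> {0..1}" "t \<in> {0..1}" and st: "s \<le> t" for s t
  proof -
    obtain r where r: "r \<in> {s..t}"
      "norm (F (?p t) - F (?p s)) \<le> (L0 + L1 * norm (F (?p r)) powr \<alpha>) * ((t - s) * norm (x - y))"
      using alpha_symmetric_Lipschitz_segment[OF lip st] by blast
    have "r \<in> {0..1}" using r(1) that(1,2) by auto
    then have "(L0 + L1 * norm (F (?p r)) powr \<alpha>) * ((t - s) * norm (x - y))
        \<le> (L0 + L1 * norm (F (?p m)) powr \<alpha>) * ((t - s) * norm (x - y))"
      using m L st by (intro mult_right_mono add_left_mono mult_left_mono) auto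
    then show ?thesis using r(2) st by (simp add: dist_norm norm_minus_commute mult_ac)
  qed
  have "?C-lipschitz_on {0..1} (\<lambda>t. F (?p t))"
  proof (rule lipschitz_onI)
    show "0 \<le> ?C" using L by (intro mult_nonneg_nonneg add_nonneg_nonneg) auto
    show "dist (F (?p s)) (F (?p t)) \<le> ?C * dist s t" if "s \<in> {0..1}" "t \<in> {0..1}" for s t
      using ordered[of s t] ordered[of t s] that by (cases "s \<le> t") (auto simp: dist_commute)
  qed
  then show ?thesis by (rule lipschitz_on_continuous_on)
qed

text \<open>
  The shift \<open>c\<close>, chosen with \<open>L\<^sub>1 c\<^sup>\<alpha> = L\<^sub>0\<close>, absorbs the constant term:
  \<open>L\<^sub>0 + L\<^sub>1 h\<^sup>\<alpha> = L\<^sub>1 (c\<^sup>\<alpha> + h\<^sup>\<alpha>) \<le> L\<^sub>1 2 powr (1 - \<alpha>) (h + c)\<^sup>\<alpha>\<close>. Comparison then bounds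
  \<open>(h + c) powr (1 - \<alpha>)\<close> by a sum of two terms. Raising this to the power \<open>1 / (1 - \<alpha>)\<close> costs
  the factor \<open>2 powr (\<alpha> / (1 - \<alpha>))\<close> by convexity, which the final power \<open>\<alpha>\<close> turns into the
  \<open>2 powr (\<alpha>\<^sup>2 / (1 - \<alpha>))\<close> of the constants; the sum is then split by subadditivity. The term in
  \<open>\<parallel>x - y\<parallel>\<close> comes out with the factor \<open>2\<^sup>\<alpha>\<close>, which is below the \<open>3\<^sup>\<alpha>\<close> in \<open>K\<^sub>2\<close>.
\<close>

lemma alpha_symmetric_Lipschitz_growth:
  fixes F :: "real ^ 'n \<Rightarrow> real ^ 'n" and \<alpha> L0 L1 :: real
  assumes lip: "alpha_symmetric_Lipschitz \<alpha> L0 L1 F"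
    and \<alpha>: "0 < \<alpha>" "\<alpha> < 1" and L1: "0 < L1" and T: "0 \<le> T" "T \<le> 1"
  shows "L1 * norm (F (T *\<^sub>R x + (1 - T) *\<^sub>R y)) powr \<alpha>
    \<le> 2 powr (\<alpha>\<^sup>2 / (1 - \<alpha>)) * L0 + K\<^sub>1 \<alpha> L1 * norm (F y) powr \<alpha>
       + K\<^sub>2 \<alpha> L1 * norm (x - y) powr (\<alpha> / (1 - \<alpha>))"
proof -
  let ?p = "\<lambda>\<theta>. \<theta> *\<^sub>R x + (1 - \<theta>) *\<^sub>R y"
  define d where "d = norm (x - y)"
  define c where "c = (L0 / L1) powr (1 / \<alpha>)"
  define M where "M = L1 * 2 powr (1 - \<alpha>) * d"
  define q where "q = 1 / (1 - \<alpha>)"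
  define u where "u t = norm (F (?p t)) + c" for t
  have L0: "0 \<le> L0" using lip by (auto simp: alpha_symmetric_Lipschitz_def)
  have c: "0 \<le> c" "L1 * c powr \<alpha> = L0" using \<alpha> L0 L1 by (auto simp: c_def powr_powr)
  have d: "0 \<le> d" and M: "0 \<le> M" using L1 by (auto simp: d_def M_def)
  have q: "1 < q" "(1 - \<alpha>) * q = 1" "q - 1 = \<alpha> / (1 - \<alpha>)" "q * \<alpha> = \<alpha> / (1 - \<alpha>)"
    "\<alpha> * (\<alpha> / (1 - \<alpha>)) = \<alpha>\<^sup>2 / (1 - \<alpha>)"
    using \<alpha> by (auto simp: q_def field_simps power2_eq_square)
  have u_nonneg: "0 \<le> u t" for t using c by (simp add: u_def)
  have "u T powr (1 - \<alpha>) \<le> u 0 powr (1 - \<alpha>) + (1 - \<alpha>) * M * T"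
  proof (rule power_growth_comparison[OF T(1) M \<alpha> _ u_nonneg])
    have "continuous_on {0..1} u"
      unfolding u_def
      by (intro continuous_intros alpha_symmetric_Lipschitz_continuous_segment[OF lip])
    then show "continuous_on {0..T} u"
      by (rule continuous_on_subset) (use T in auto)
    fix s t :: real assume "s \<le> t"
    then obtain r where r: "r \<in> {s..t}"
      "norm (F (?p t) - F (?p s)) \<le> (L0 + L1 * norm (F (?p r)) powr \<alpha>) * ((t - s) * d)"
      using alpha_symmetric_Lipschitz_segment[OF lip] unfolding d_def by blast
    have "L0 + L1 * norm (F (?p r)) powr \<alpha> = L1 * (norm (F (?p r)) powr \<alpha> + c powr \<alpha>)"
      using c by (simp add: algebra_simps)
    also have "\<dots> \<le> L1 * (2 powr (1 - \<alpha>) * u r powr \<alpha>)"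
      unfolding u_def using L1 c \<alpha> by (intro mult_left_mono powr_add_powr_le) auto
    finally have "(L0 + L1 * norm (F (?p r)) powr \<alpha>) * ((t - s) * d)
        \<le> L1 * (2 powr (1 - \<alpha>) * u r powr \<alpha>) * ((t - s) * d)"
      using d \<open>s \<le> t\<close> by (intro mult_right_mono) auto
    moreover have "u t - u s \<le> norm (F (?p t) - F (?p s))"
      by (simp add: u_def norm_triangle_ineq2)
    ultimately have "u t - u s \<le> M * u r powr \<alpha> * (t - s)"
      using r(2) by (simp add: M_def mult_ac)
    then show "\<exists>r\<in>{s..t}. u t - u s \<le> M * u r powr \<alpha> * (t - s)" using r(1) by blast
  qed
  also have "(1 - \<alpha>) * M * T \<le> (1 - \<alpha>) * M"
    using T M \<alpha> by (intro mult_left_le) auto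
  finally have grow: "u T powr (1 - \<alpha>) \<le> u 0 powr (1 - \<alpha>) + (1 - \<alpha>) * M" by simp
  define Y where "Y = ((1 - \<alpha>) * M) powr q"
  have "u T = (u T powr (1 - \<alpha>)) powr q" using q(2) u_nonneg by (simp add: powr_powr)
  also have "\<dots> \<le> (u 0 powr (1 - \<alpha>) + (1 - \<alpha>) * M) powr q"
    using q(1) grow by (intro powr_mono2) auto
  also have "\<dots> \<le> 2 powr (q - 1) * ((u 0 powr (1 - \<alpha>)) powr q + Y)"
    unfolding Y_def using M \<alpha> q(1) by (intro powr_add_le_two_powr) auto
  also have "\<dots> = 2 powr (q - 1) * (norm (F y) + (c + Y))"
    using q(2) u_nonneg[of 0] by (simp add: powr_powr u_def)
  finally have "norm (F (?p T)) \<le> 2 powr (q - 1) * (norm (F y) + (c + Y))"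
    using c by (simp add: u_def)
  then have "norm (F (?p T)) powr \<alpha> \<le> (2 powr (q - 1) * (norm (F y) + (c + Y))) powr \<alpha>"
    using \<alpha> by (intro powr_mono2) auto
  also have "\<dots> = 2 powr (\<alpha>\<^sup>2 / (1 - \<alpha>)) * (norm (F y) + (c + Y)) powr \<alpha>"
    unfolding powr_mult powr_powr q(3) mult.commute[of "\<alpha> / (1 - \<alpha>)" \<alpha>] q(5) ..
  also have "(norm (F y) + (c + Y)) powr \<alpha> \<le> norm (F y) powr \<alpha> + (c + Y) powr \<alpha>"
    using \<alpha> c by (intro powr_add_le_powr_add) (auto simp: Y_def)
  also have "(c + Y) powr \<alpha> \<le> c powr \<alpha> + Y powr \<alpha>"
    using \<alpha> c by (intro powr_add_le_powr_add) (auto simp: Y_def)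
  finally have "norm (F (?p T)) powr \<alpha>
      \<le> 2 powr (\<alpha>\<^sup>2 / (1 - \<alpha>)) * (norm (F y) powr \<alpha> + (c powr \<alpha> + Y powr \<alpha>))"
    by simp
  then have "L1 * norm (F (?p T)) powr \<alpha>
      \<le> L1 * (2 powr (\<alpha>\<^sup>2 / (1 - \<alpha>)) * (norm (F y) powr \<alpha> + (c powr \<alpha> + Y powr \<alpha>)))"
    using L1 by (intro mult_left_mono) auto
  also have "\<dots> = 2 powr (\<alpha>\<^sup>2 / (1 - \<alpha>)) * L0 + K\<^sub>1 \<alpha> L1 * norm (F y) powr \<alpha>
      + 2 powr (\<alpha>\<^sup>2 / (1 - \<alpha>)) * (L1 * Y powr \<alpha>)"
    unfolding K\<^sub>1_def c(2)[symmetric] by (simp add: algebra_simps)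
  also have "2 powr (\<alpha>\<^sup>2 / (1 - \<alpha>)) * (L1 * Y powr \<alpha>)
      \<le> K\<^sub>2 \<alpha> L1 * d powr (\<alpha> / (1 - \<alpha>))"
  proof -
    have two: "((2::real) powr (1 - \<alpha>)) powr (\<alpha> / (1 - \<alpha>)) = 2 powr \<alpha>"
      using \<alpha> by (simp add: powr_powr)
    have "1 + \<alpha> / (1 - \<alpha>) = 1 / (1 - \<alpha>)" using \<alpha> by (simp add: field_simps)
    then have one: "L1 * L1 powr (\<alpha> / (1 - \<alpha>)) = L1 powr (1 / (1 - \<alpha>))"
      using powr_mult_base[of L1 "\<alpha> / (1 - \<alpha>)"] L1 by simp
    have "L1 * Y powr \<alpha> = L1 * ((1 - \<alpha>) * (L1 * 2 powr (1 - \<alpha>) * d)) powr (\<alpha> / (1 - \<alpha>))"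
      by (simp add: Y_def M_def powr_powr q(4))
    also have "\<dots> = (1 - \<alpha>) powr (\<alpha> / (1 - \<alpha>)) * (L1 * L1 powr (\<alpha> / (1 - \<alpha>)))
        * d powr (\<alpha> / (1 - \<alpha>)) * 2 powr \<alpha>"
      by (simp add: powr_mult two)
    also have "\<dots> \<le> (1 - \<alpha>) powr (\<alpha> / (1 - \<alpha>)) * (L1 * L1 powr (\<alpha> / (1 - \<alpha>)))
        * d powr (\<alpha> / (1 - \<alpha>)) * 3 powr \<alpha>"
      using \<alpha> L1 by (intro mult_left_mono powr_mono2) auto
    finally have "2 powr (\<alpha>\<^sup>2 / (1 - \<alpha>)) * (L1 * Y powr \<alpha>) \<le> 2 powr (\<alpha>\<^sup>2 / (1 - \<alpha>)) *
        ((1 - \<alpha>) powr (\<alpha> / (1 - \<alpha>)) * (L1 * L1 powr (\<alpha> / (1 - \<alpha>)))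
        * d powr (\<alpha> / (1 - \<alpha>)) * 3 powr \<alpha>)"
      by (rule mult_left_mono) simp
    also have "\<dots> = K\<^sub>2 \<alpha> L1 * d powr (\<alpha> / (1 - \<alpha>))"
      unfolding K\<^sub>2_def one by (simp add: mult_ac)
    finally show ?thesis .
  qed
  finally show ?thesis by (simp add: d_def)
qed

text \<open>
  The growth bound is applied at a maximiser on the segment. For \<open>L\<^sub>1 = 0\<close>, where the shift \<open>c\<close> has no
  meaning, the map is Lipschitz with constant \<open>L\<^sub>0 \<le> K\<^sub>0\<close>.
\<close>

lemma alpha_symmetric_Lipschitz_base_point_bound:
  fixes F :: "real ^ 'n \<Rightarrow> real ^ 'n" and \<alpha> L0 L1 :: real
  assumes lip: "alpha_symmetric_Lipschitz \<alpha> L0 L1 F"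
    and \<alpha>: "0 < \<alpha>" "\<alpha> < 1"
  shows "norm (F x - F y) \<le> (K\<^sub>0 \<alpha> L0 + K\<^sub>1 \<alpha> L1 * norm (F y) powr \<alpha>
           + K\<^sub>2 \<alpha> L1 * norm (x - y) powr (\<alpha> / (1 - \<alpha>))) * norm (x - y)"
proof -
  let ?p = "\<lambda>\<theta>. \<theta> *\<^sub>R x + (1 - \<theta>) *\<^sub>R y"
  have L: "0 \<le> L0" "0 \<le> L1" using lip by (auto simp: alpha_symmetric_Lipschitz_def)
  obtain m where m: "m \<in> {0..1}"
    "norm (F x - F y) \<le> (L0 + L1 * norm (F (?p m)) powr \<alpha>) * norm (x - y)"
    using lip unfolding alpha_symmetric_Lipschitz_def is_arg_max_linorder by blast
  have "L0 + L1 * norm (F (?p m)) powr \<alpha> \<le> K\<^sub>0 \<alpha> L0 + K\<^sub>1 \<alpha> L1 * norm (F y) powr \<alpha>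
           + K\<^sub>2 \<alpha> L1 * norm (x - y) powr (\<alpha> / (1 - \<alpha>))"
  proof (cases "L1 = 0")
    case True
    then show ?thesis using L by (simp add: K\<^sub>0_def K\<^sub>1_def K\<^sub>2_def algebra_simps)
  next
    case False
    then show ?thesis
      using alpha_symmetric_Lipschitz_growth[OF lip \<alpha>, of m x y] L m(1)
      by (simp add: K\<^sub>0_def algebra_simps)
  qed
  then show ?thesis
    using m(2) mult_right_mono[OF _ norm_ge_zero[of "x - y"]] by (meson order_trans)
qed

section \<open>One extragradient step\<close>

text \<open>
  Strong monotonicity gives \<open>\<mu> \<parallel>v\<parallel> \<le> \<parallel>F (x + v) - F x\<parallel>\<close>. Dividing the base point bound by \<open>\<parallel>v\<parallel>\<close>
  leaves an excess term with a positive power of \<open>\<parallel>v\<parallel>\<close>, which vanishes as \<open>v\<close> tends to zero.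
\<close>

lemma strong_monotonicity_modulus_le:
  fixes F :: "real ^ 'n \<Rightarrow> real ^ 'n" and \<alpha> L0 L1 \<mu> :: real
  assumes mono: "strongly_monotone \<mu> F"
    and lip: "alpha_symmetric_Lipschitz \<alpha> L0 L1 F"
    and \<alpha>: "0 < \<alpha>" "\<alpha> < 1"
  shows "\<mu> \<le> K\<^sub>0 \<alpha> L0 + K\<^sub>1 \<alpha> L1 * norm (F x) powr \<alpha>"
proof (rule field_le_epsilon)
  fix e :: real assume e: "0 < e"
  let ?p = "\<alpha> / (1 - \<alpha>)"
  have K2: "0 \<le> K\<^sub>2 \<alpha> L1" using \<alpha> by (simp add: K\<^sub>2_def)
  \<comment> \<open>Adding one to \<open>K\<^sub>2\<close> keeps the quotient defined when \<open>K\<^sub>2 = 0\<close>.\<close>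
  define \<epsilon> where "\<epsilon> = (e / (K\<^sub>2 \<alpha> L1 + 1)) powr (1 / ?p)"
  have \<epsilon>: "0 < \<epsilon>" "\<epsilon> powr ?p = e / (K\<^sub>2 \<alpha> L1 + 1)"
    using e K2 \<alpha> by (auto simp: \<epsilon>_def powr_powr)
  obtain v :: "real ^ 'n" where v: "norm v = \<epsilon>"
    using vector_choose_size[of \<epsilon>] \<epsilon>(1) by auto
  have "\<mu> * \<epsilon>\<^sup>2 \<le> (F (x + v) - F x) \<bullet> v"
    using mono v unfolding strongly_monotone_def by (metis add_diff_cancel_left')
  also have "\<dots> \<le> norm (F (x + v) - F x) * \<epsilon>" using norm_cauchy_schwarz v by metis
  also have "\<dots> \<le> (K\<^sub>0 \<alpha> L0 + K\<^sub>1 \<alpha> L1 * norm (F x) powr \<alpha> + K\<^sub>2 \<alpha> L1 * \<epsilon> powr ?p) * \<epsilon> * \<epsilon>"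
    using alpha_symmetric_Lipschitz_base_point_bound[OF lip \<alpha>, of "x + v" x] v \<epsilon>(1)
    by (intro mult_right_mono) auto
  finally have "\<mu> * \<epsilon>\<^sup>2
      \<le> (K\<^sub>0 \<alpha> L0 + K\<^sub>1 \<alpha> L1 * norm (F x) powr \<alpha> + K\<^sub>2 \<alpha> L1 * \<epsilon> powr ?p) * \<epsilon>\<^sup>2"
    by (simp add: power2_eq_square)
  then have "\<mu> \<le> K\<^sub>0 \<alpha> L0 + K\<^sub>1 \<alpha> L1 * norm (F x) powr \<alpha> + K\<^sub>2 \<alpha> L1 * \<epsilon> powr ?p"
    using \<epsilon>(1) by simp
  also have "K\<^sub>2 \<alpha> L1 * \<epsilon> powr ?p \<le> e"
    using K2 e unfolding \<epsilon>(2) by (simp add: field_simps)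
  finally show "\<mu> \<le> K\<^sub>0 \<alpha> L0 + K\<^sub>1 \<alpha> L1 * norm (F x) powr \<alpha> + e" by simp
qed

text \<open>
  Splitting \<open>x - xstar\<close> at \<open>z\<close> and polarising \<open>F z \<bullet> F x\<close> gives the exact identity
  \<open>\<parallel>x - \<gamma> F z - xstar\<parallel>\<^sup>2 = \<parallel>x - xstar\<parallel>\<^sup>2 - 2 \<gamma> (F z \<bullet> (z - xstar)) - \<parallel>x - z\<parallel>\<^sup>2 + \<gamma>\<^sup>2 \<parallel>F x - F z\<parallel>\<^sup>2\<close>.
  Monotonicity yields decrease in terms of \<open>\<parallel>z - xstar\<parallel>\<close>; passing to \<open>\<parallel>x - xstar\<parallel>\<close> by the
  parallelogram inequality costs \<open>2 \<gamma> \<mu> \<parallel>x - z\<parallel>\<^sup>2\<close>, which the remaining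
  \<open>- (1 - \<nu>\<^sup>2) \<parallel>x - z\<parallel>\<^sup>2\<close> pays for.
\<close>

lemma extragradient_step_contracts:
  fixes F :: "'a::real_inner \<Rightarrow> 'a" and x z xstar :: 'a and \<gamma> \<mu> \<nu> :: real
  assumes z: "z = x - \<gamma> *\<^sub>R F x"
    and \<gamma>: "0 \<le> \<gamma>" and \<nu>: "0 \<le> \<nu>"
    and mono: "\<mu> * (norm (z - xstar))\<^sup>2 \<le> F z \<bullet> (z - xstar)"
    and \<mu>: "0 \<le> \<mu>"
    and near: "\<gamma> * norm (F x - F z) \<le> \<nu> * norm (x - z)"
    and small: "2 * \<gamma> * \<mu> \<le> 1 - \<nu>\<^sup>2"
  shows "(norm (x - \<gamma> *\<^sub>R F z - xstar))\<^sup>2 \<le> (1 - \<gamma> * \<mu>) * (norm (x - xstar))\<^sup>2"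
proof -
  have "(norm (x - \<gamma> *\<^sub>R F z - xstar))\<^sup>2
      = (norm (x - xstar))\<^sup>2 - 2 * \<gamma> * (F z \<bullet> (z - xstar))
        - (norm (x - z))\<^sup>2 + (\<gamma> * norm (F x - F z))\<^sup>2"
    unfolding z power_mult_distrib power2_norm_eq_inner
    by (simp add: inner_simps inner_commute algebra_simps power2_eq_square)
  also have "(\<gamma> * norm (F x - F z))\<^sup>2 \<le> (\<nu> * norm (x - z))\<^sup>2"
    using near \<gamma> by (intro power_mono) auto
  finally have "(norm (x - \<gamma> *\<^sub>R F z - xstar))\<^sup>2
      \<le> (norm (x - xstar))\<^sup>2 - 2 * \<gamma> * (F z \<bullet> (z - xstar))
        - (norm (x - z))\<^sup>2 + (\<nu> * norm (x - z))\<^sup>2"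
    by simp
  moreover have "2 * \<gamma> * (\<mu> * (norm (z - xstar))\<^sup>2) \<le> 2 * \<gamma> * (F z \<bullet> (z - xstar))"
    using mono \<gamma> by (intro mult_left_mono) auto
  ultimately have descent: "(norm (x - \<gamma> *\<^sub>R F z - xstar))\<^sup>2
      \<le> (norm (x - xstar))\<^sup>2 - \<gamma> * \<mu> * (2 * (norm (z - xstar))\<^sup>2) - (1 - \<nu>\<^sup>2) * (norm (x - z))\<^sup>2"
    by (simp add: algebra_simps power_mult_distrib)
  have "(norm (x - xstar))\<^sup>2 \<le> (norm (x - z) + norm (z - xstar))\<^sup>2"
    using norm_triangle_ineq[of "x - z" "z - xstar"] by (intro power_mono) auto
  also have "\<dots> \<le> 2 * (norm (x - z))\<^sup>2 + 2 * (norm (z - xstar))\<^sup>2"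
    using zero_le_power2[of "norm (x - z) - norm (z - xstar)"]
    by (simp add: power2_eq_square algebra_simps)
  finally have "\<gamma> * \<mu> * ((norm (x - xstar))\<^sup>2 - 2 * (norm (x - z))\<^sup>2)
      \<le> \<gamma> * \<mu> * (2 * (norm (z - xstar))\<^sup>2)"
    using \<gamma> \<mu> by (intro mult_left_mono) auto
  moreover have "2 * \<gamma> * \<mu> * (norm (x - z))\<^sup>2 \<le> (1 - \<nu>\<^sup>2) * (norm (x - z))\<^sup>2"
    using small by (intro mult_right_mono) auto
  ultimately show ?thesis using descent by (simp add: algebra_simps)
qed

text \<open>
  The denominator \<open>N\<close> splits into two parts, each responsible for half of the bound. The part
  \<open>2 (a + b f\<^sup>\<alpha>)\<close> gives \<open>\<gamma> (a + b f\<^sup>\<alpha>) \<le> \<nu> / 2\<close> for \<open>\<gamma> = \<nu> / N\<close>. For the other, twice the last term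
  equals \<open>(\<gamma> (2 k) powr (1 - \<alpha>) f\<^sup>\<alpha>) powr (1 / (1 - \<alpha>)) \<le> \<nu> powr (1 / (1 - \<alpha>)) \<le> \<nu>\<close>.
\<close>

lemma stepsize_bound:
  fixes a b k f \<alpha> \<nu> N :: real
  assumes nonneg: "0 \<le> a" "0 \<le> b" "0 \<le> k" "0 \<le> f"
    and \<alpha>: "0 < \<alpha>" "\<alpha> < 1" and \<nu>: "0 < \<nu>" "\<nu> < 1"
    and N: "N = 2 * a + (2 * b + 2 powr (1 - \<alpha>) * k powr (1 - \<alpha>)) * f powr \<alpha>" "0 < N"
  shows "\<nu> / N * (a + b * f powr \<alpha> + k * (\<nu> / N * f) powr (\<alpha> / (1 - \<alpha>))) \<le> \<nu>"
proof -
  define \<gamma> where "\<gamma> = \<nu> / N"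
  have \<gamma>: "0 < \<gamma>" "\<gamma> * N = \<nu>" using N(2) \<nu> by (auto simp: \<gamma>_def)
  have "2 * (a + b * f powr \<alpha>) \<le> N" using N(1) nonneg by (simp add: algebra_simps)
  then have "\<gamma> * (2 * (a + b * f powr \<alpha>)) \<le> \<nu>"
    using \<gamma> mult_left_mono[of _ N \<gamma>] by fastforce
  then have first: "\<gamma> * (a + b * f powr \<alpha>) \<le> \<nu> / 2" by (simp add: algebra_simps)
  have "2 powr (1 - \<alpha>) * k powr (1 - \<alpha>) * f powr \<alpha> \<le> N"
    using N(1) nonneg by (simp add: algebra_simps)
  then have le: "\<gamma> * (2 powr (1 - \<alpha>) * k powr (1 - \<alpha>) * f powr \<alpha>) \<le> \<nu>"
    using \<gamma> mult_left_mono[of _ N \<gamma>] by fastforce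
  have e: "(1 - \<alpha>) * (1 / (1 - \<alpha>)) = 1" "\<alpha> * (1 / (1 - \<alpha>)) = \<alpha> / (1 - \<alpha>)"
    "1 / (1 - \<alpha>) = 1 + \<alpha> / (1 - \<alpha>)" "1 \<le> 1 / (1 - \<alpha>)"
    using \<alpha> by (auto simp: field_simps)
  have "2 * (\<gamma> * (k * (\<gamma> * f) powr (\<alpha> / (1 - \<alpha>))))
      = 2 * k * (\<gamma> * \<gamma> powr (\<alpha> / (1 - \<alpha>))) * f powr (\<alpha> / (1 - \<alpha>))"
    by (simp add: powr_mult mult_ac)
  also have "\<gamma> * \<gamma> powr (\<alpha> / (1 - \<alpha>)) = \<gamma> powr (1 / (1 - \<alpha>))"
    using \<gamma> powr_mult_base[of \<gamma>] unfolding e(3) by simp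
  also have "2 * k * \<gamma> powr (1 / (1 - \<alpha>)) * f powr (\<alpha> / (1 - \<alpha>))
      = (\<gamma> * (2 powr (1 - \<alpha>) * k powr (1 - \<alpha>) * f powr \<alpha>)) powr (1 / (1 - \<alpha>))"
    using nonneg unfolding powr_mult powr_powr e(1,2) by simp
  also have "\<dots> \<le> \<nu> powr (1 / (1 - \<alpha>))"
    using le \<alpha> \<gamma> nonneg by (intro powr_mono2) auto
  also have "\<dots> \<le> \<nu>" using powr_mono'[OF e(4), of \<nu>] \<nu> by simp
  finally show ?thesis using first unfolding \<gamma>_def[symmetric] by (simp add: algebra_simps)
qed

section \<open>Linear convergence\<close>

theorem theorem4p3:
  fixes F :: "real ^ 'n \<Rightarrow> real ^ 'n"
    and \<alpha> L\<^sub>0 L\<^sub>1 \<mu> \<nu> \<rho> :: real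
    and \<gamma> \<omega> :: "nat \<Rightarrow> real"
    and x xhat :: "nat \<Rightarrow> real ^ 'n"
    and xstar :: "real ^ 'n"
  assumes "strongly_monotone \<mu> F"
    and "0 < \<alpha>" and "\<alpha> < 1"
    and "alpha_symmetric_Lipschitz \<alpha> L\<^sub>0 L\<^sub>1 F"
    and "F xstar = 0"
    and "0 < \<nu>" and "\<nu> < 1" and "1 - \<nu> - \<nu>\<^sup>2 = 0"
    and "extragradient F \<gamma> \<omega> x xhat"
    and "\<And>k. \<gamma> k = \<nu> / (2 * K\<^sub>0 \<alpha> L\<^sub>0
           + (2 * K\<^sub>1 \<alpha> L\<^sub>1 + 2 powr (1 - \<alpha>) * K\<^sub>2 \<alpha> L\<^sub>1 powr (1 - \<alpha>)) * norm (F (x k)) powr \<alpha>)"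
    and "\<And>k. \<omega> k = \<gamma> k"
    and "\<rho> = \<nu> * \<mu> / (2 * K\<^sub>0 \<alpha> L\<^sub>0
           + (2 * K\<^sub>1 \<alpha> L\<^sub>1 + 2 powr (1 - \<alpha>) * K\<^sub>2 \<alpha> L\<^sub>1 powr (1 - \<alpha>))
             * (K\<^sub>0 \<alpha> L\<^sub>0 + K\<^sub>2 \<alpha> L\<^sub>1 * norm (x 0 - xstar) powr (\<alpha> / (1 - \<alpha>))) powr \<alpha>
             * norm (x 0 - xstar) powr \<alpha>)"
  shows "\<forall>k. (norm (x (k + 1) - xstar))\<^sup>2 \<le> (1 - \<rho>) ^ (k + 1) * (norm (x 0 - xstar))\<^sup>2"
proof -
  note mono = assms(1) and \<alpha> = assms(2,3) and lip = assms(4) and root = assms(5)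
    and \<nu> = assms(6,7)
  let ?p = "\<alpha> / (1 - \<alpha>)"
  \<comment> \<open>\<open>N k\<close> and \<open>D\<close> are the denominators of \<open>\<gamma> k\<close> and \<open>\<rho>\<close>.\<close>
  define C where "C = 2 * K\<^sub>1 \<alpha> L\<^sub>1 + 2 powr (1 - \<alpha>) * K\<^sub>2 \<alpha> L\<^sub>1 powr (1 - \<alpha>)"
  define N where "N k = 2 * K\<^sub>0 \<alpha> L\<^sub>0 + C * norm (F (x k)) powr \<alpha>" for k
  define d where "d k = norm (x k - xstar)" for k
  define D where "D = 2 * K\<^sub>0 \<alpha> L\<^sub>0 + C * (K\<^sub>0 \<alpha> L\<^sub>0 + K\<^sub>2 \<alpha> L\<^sub>1 * d 0 powr ?p) powr \<alpha> * d 0 powr \<alpha>"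
  have L: "0 \<le> L\<^sub>0" "0 \<le> L\<^sub>1" using lip by (auto simp: alpha_symmetric_Lipschitz_def)
  have K: "0 \<le> K\<^sub>0 \<alpha> L\<^sub>0" "0 \<le> K\<^sub>1 \<alpha> L\<^sub>1" "0 \<le> K\<^sub>2 \<alpha> L\<^sub>1"
    using L by (auto simp: K\<^sub>0_def K\<^sub>1_def K\<^sub>2_def)
  have C: "0 \<le> C" "2 * K\<^sub>1 \<alpha> L\<^sub>1 \<le> C" using K by (auto simp: C_def)
  have \<mu>: "0 < \<mu>" using mono by (simp add: strongly_monotone_def)
  have \<nu>2: "1 - \<nu>\<^sup>2 = \<nu>" using assms(8) by simp
  have \<gamma>: "\<gamma> k = \<nu> / N k" for k using assms(10) by (simp add: N_def C_def)
  have \<rho>: "\<rho> = \<nu> * \<mu> / D" using assms(12) by (simp add: D_def C_def d_def)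
  have N\<mu>: "2 * \<mu> \<le> N k" for k
  proof -
    have "2 * \<mu> \<le> 2 * K\<^sub>0 \<alpha> L\<^sub>0 + 2 * K\<^sub>1 \<alpha> L\<^sub>1 * norm (F (x k)) powr \<alpha>"
      using strong_monotonicity_modulus_le[OF mono lip \<alpha>, of "x k"] by simp
    also have "\<dots> \<le> N k" unfolding N_def using C by (intro add_left_mono mult_right_mono) auto
    finally show ?thesis .
  qed
  then have Npos: "0 < N k" for k using \<mu> by (meson less_le_trans mult_pos_pos zero_less_numeral)
  have \<gamma>pos: "0 < \<gamma> k" for k using \<gamma> \<nu> Npos by simp
  have \<gamma>\<mu>: "2 * \<gamma> k * \<mu> \<le> \<nu>" for k
  proof -
    have "\<gamma> k * (2 * \<mu>) \<le> \<gamma> k * N k"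
      using N\<mu>[of k] \<gamma>pos[of k] by (intro mult_left_mono) auto
    also have "\<dots> = \<nu>" using \<gamma>[of k] Npos[of k] by simp
    finally show ?thesis by simp
  qed
  have step: "(d (Suc k))\<^sup>2 \<le> (1 - \<gamma> k * \<mu>) * (d k)\<^sup>2" for k
  proof -
    have hat: "xhat k = x k - \<gamma> k *\<^sub>R F (x k)" and nxt: "x (Suc k) = x k - \<gamma> k *\<^sub>R F (xhat k)"
      using assms(9,11) by (auto simp: extragradient_def)
    have len: "norm (xhat k - x k) = \<gamma> k * norm (F (x k))"
      using \<gamma>pos[of k] by (simp add: hat)
    have "norm (F (xhat k) - F (x k)) \<le> (K\<^sub>0 \<alpha> L\<^sub>0 + K\<^sub>1 \<alpha> L\<^sub>1 * norm (F (x k)) powr \<alpha>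
        + K\<^sub>2 \<alpha> L\<^sub>1 * (\<gamma> k * norm (F (x k))) powr ?p) * norm (xhat k - x k)"
      using alpha_symmetric_Lipschitz_base_point_bound[OF lip \<alpha>, of "xhat k" "x k"]
      unfolding len .
    then have "\<gamma> k * norm (F (xhat k) - F (x k)) \<le> \<gamma> k * ((K\<^sub>0 \<alpha> L\<^sub>0 + K\<^sub>1 \<alpha> L\<^sub>1 * norm (F (x k)) powr \<alpha>
        + K\<^sub>2 \<alpha> L\<^sub>1 * (\<gamma> k * norm (F (x k))) powr ?p) * norm (xhat k - x k))"
      using \<gamma>pos[of k] by (intro mult_left_mono) auto
    also have "\<dots> = \<gamma> k * (K\<^sub>0 \<alpha> L\<^sub>0 + K\<^sub>1 \<alpha> L\<^sub>1 * norm (F (x k)) powr \<alpha>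
        + K\<^sub>2 \<alpha> L\<^sub>1 * (\<gamma> k * norm (F (x k))) powr ?p) * norm (xhat k - x k)"
      by (rule mult.assoc[symmetric])
    also have "\<dots> \<le> \<nu> * norm (xhat k - x k)"
      using stepsize_bound[OF K norm_ge_zero \<alpha> \<nu> N_def[unfolded C_def] Npos]
      unfolding \<gamma>[symmetric] by (rule mult_right_mono) simp
    finally have near: "\<gamma> k * norm (F (x k) - F (xhat k)) \<le> \<nu> * norm (x k - xhat k)"
      by (simp add: norm_minus_commute)
    have "\<mu> * (norm (xhat k - xstar))\<^sup>2 \<le> (F (xhat k) - F xstar) \<bullet> (xhat k - xstar)"
      using mono by (simp add: strongly_monotone_def)
    then show ?thesis
      unfolding d_def nxt
      by (intro extragradient_step_contracts[OF hat _ _ _ _ near])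
        (use \<gamma>pos[of k] \<nu> \<mu> \<gamma>\<mu>[of k] \<nu>2 root in auto)
  qed
  have decr: "d k \<le> d 0" for k
  proof (induction k)
    case (Suc k)
    have "(1 - \<gamma> k * \<mu>) * (d k)\<^sup>2 \<le> 1 * (d k)\<^sup>2"
      using \<gamma>pos[of k] \<mu> by (intro mult_right_mono) auto
    then have "(d (Suc k))\<^sup>2 \<le> (d k)\<^sup>2" using step[of k] by linarith
    then have "d (Suc k) \<le> d k" by (rule power2_le_imp_le) (simp add: d_def)
    then show ?case using Suc by simp
  qed simp
  have ND: "N k \<le> D" for k
  proof -
    have d: "0 \<le> d k" "0 \<le> d 0" by (auto simp: d_def)
    have "norm (F (x k)) \<le> (K\<^sub>0 \<alpha> L\<^sub>0 + K\<^sub>2 \<alpha> L\<^sub>1 * d k powr ?p) * d k"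
      using alpha_symmetric_Lipschitz_base_point_bound[OF lip \<alpha>, of "x k" xstar]
      by (simp add: root d_def)
    also have "\<dots> \<le> (K\<^sub>0 \<alpha> L\<^sub>0 + K\<^sub>2 \<alpha> L\<^sub>1 * d 0 powr ?p) * d 0"
      using decr[of k] d K \<alpha>
      by (intro mult_mono add_left_mono mult_left_mono powr_mono2) auto
    finally have "norm (F (x k)) powr \<alpha> \<le> ((K\<^sub>0 \<alpha> L\<^sub>0 + K\<^sub>2 \<alpha> L\<^sub>1 * d 0 powr ?p) * d 0) powr \<alpha>"
      using \<alpha> by (intro powr_mono2) auto
    then have "C * norm (F (x k)) powr \<alpha>
        \<le> C * ((K\<^sub>0 \<alpha> L\<^sub>0 + K\<^sub>2 \<alpha> L\<^sub>1 * d 0 powr ?p) powr \<alpha> * d 0 powr \<alpha>)"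
      unfolding powr_mult using C(1) by (intro mult_left_mono)
    then show ?thesis by (simp add: N_def D_def mult.assoc)
  qed
  have \<rho>\<gamma>: "\<rho> \<le> \<gamma> k * \<mu>" for k
    using ND[of k] Npos[of k] \<nu> \<mu> unfolding \<rho> \<gamma>
    by (simp add: frac_le)
  have rate: "0 \<le> 1 - \<rho>" using \<rho>\<gamma>[of 0] \<gamma>\<mu>[of 0] \<nu> by linarith
  have "(d k)\<^sup>2 \<le> (1 - \<rho>) ^ k * (d 0)\<^sup>2" for k
  proof (induction k)
    case (Suc k)
    have "(d (Suc k))\<^sup>2 \<le> (1 - \<rho>) * (d k)\<^sup>2"
      using step[of k] mult_right_mono[of "1 - \<gamma> k * \<mu>" "1 - \<rho>" "(d k)\<^sup>2"] \<rho>\<gamma>[of k] by simp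
    also have "\<dots> \<le> (1 - \<rho>) * ((1 - \<rho>) ^ k * (d 0)\<^sup>2)"
      using Suc rate by (rule mult_left_mono)
    finally show ?case by (simp add: mult.assoc)
  qed simp
  then show ?thesis unfolding d_def by blast
qed

end
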